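(* Let $R$ be a commutative $\mathbb{Q}$-algebra. For $t\in\Omega_R$ and $f\in\mathcal{U}(HR)$, $$\mathscr{G}(\mathcal{E}_t f)(z)=\exp\left(-t\sum_{n\ge1}\frac{\kappa_n^t(f)}{n}z^n\right)$$ in $R[[z]]$. In particular, for every $n$, $$f(n)=\frac{(t)_{\underline{n}}}{t^n}\,[z^n]\exp\left(-t\sum_{j=1}^{n}\frac{\kappa_j^t(f)}{j}z^j\right).$$ Hence the map $f\mapsto K_t^H[f]$ is injective on $\mathcal{U}(HR)$, and each coefficient $f(n)$ is a polynomial in the first $n$ cumulants $\kappa_1^t(f),\dots,\kappa_n^t(f)$.
   Context: $\mathbb{N}=\{0,1,2,\dots\}$. $HR$ is the set of all maps $f:\mathbb{N}\to R$. For $a\in R$: $(a)_{\underline{0}}=1$, $(a)_{\underline{n}}=a(a-1)\cdots(a-n+1)$ for $n\ge1$; $\Omega_R=\{t\in R:(t)_{\underline{n}}\in R^\times\text{ for every }n\ge1\}$ (so $t$ itself is a unit). $\mathcal{U}(HR)=\{f\in HR:f(0)=1\}$. $\mathscr{G}f(z)=\sum_{n\ge0}f(n)z^n\in R[[z]]$. For $t\in\Omega_R$, $(\mathcal{E}_tf)(0)=1$ and $(\mathcal{E}_tf)(n)=\frac{t^n}{(t)_{\underline{n}}}f(n)$ for $n\ge1$. The $t$-deformed Hurwitz cumulant transform of $f\in\mathcal{U}(HR)$ is the formal power series $$K_t^H[f](z)=\sum_{n\ge1}\kappa_n^t(f)z^n=-\frac{z}{t}\frac{d}{dz}\log\bigl(\mathscr{G}(\mathcal{E}_tf)(z)\bigr),$$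 where $\log$ is the formal logarithm of a series with constant term $1$; this defines the cumulants $\kappa_n^t(f)\in R$. $[z^n]F$ denotes the coefficient of $z^n$ in $F$. *)

theory Defs
  imports
    "HOL-Computational_Algebra.Formal_Power_Series"
    "HOL-Library.Poly_Mapping"
begin

text \<open>A commutative \<open>\<rat>\<close>-algebra is a commutative ring together with its structure map,
  a unital ring homomorphism from \<^typ>\<open>rat\<close>.\<close>

locale rat_algebra =
  fixes \<iota> :: "rat \<Rightarrow> 'a::comm_ring_1"
  assumes map_one: "\<iota> 1 = 1"
    and map_add: "\<iota> (p + q) = \<iota> p + \<iota> q"
    and map_mult: "\<iota> (p * q) = \<iota> p * \<iota> q"

text \<open>The inverse of a unit; the value is unspecified on non-units.\<close>

definition unit_inv :: "'a::comm_ring_1 \<Rightarrow> 'a" where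
  "unit_inv u = (THE v. u * v = 1)"

definition falling_fact :: "'a::comm_ring_1 \<Rightarrow> nat \<Rightarrow> 'a" where
  "falling_fact a n = (\<Prod>i<n. a - of_nat i)"

definition Omega :: "'a::comm_ring_1 set" where
  "Omega = {t. \<forall>n\<ge>1. falling_fact t n dvd 1}"

definition UH :: "(nat \<Rightarrow> 'a::comm_ring_1) set" where
  "UH = {f. f 0 = 1}"

text \<open>The library's \<^const>\<open>fps_exp\<close> and \<^const>\<open>fps_ln\<close> are the series of
  \<open>exp (c z)\<close> and \<open>ln (1 + z) / c\<close> over fields of characteristic 0. Here the exponential of a
  series with constant term 0 and the logarithm of a series with constant term 1 are obtained by
  substitution into the usual series, over any commutative \<open>\<rat>\<close>-algebra.\<close>

definition exp_series :: "(rat \<Rightarrow> 'a::comm_ring_1) \<Rightarrow> 'a fps \<Rightarrow> 'a fps" where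
  "exp_series \<iota> F = Abs_fps (\<lambda>n. \<iota> (1 / fact n)) oo F"

definition log_series :: "(rat \<Rightarrow> 'a::comm_ring_1) \<Rightarrow> 'a fps \<Rightarrow> 'a fps" where
  "log_series \<iota> F =
     Abs_fps (\<lambda>n. if n = 0 then 0 else \<iota> ((- 1) ^ (n + 1) / of_nat n)) oo (F - 1)"

definition gen_fun :: "(nat \<Rightarrow> 'a) \<Rightarrow> 'a fps" where
  "gen_fun f = Abs_fps f"

definition E_transform :: "'a::comm_ring_1 \<Rightarrow> (nat \<Rightarrow> 'a) \<Rightarrow> nat \<Rightarrow> 'a" where
  "E_transform t f n =
     (if n = 0 then 1 else t ^ n * unit_inv (falling_fact t n) * f n)"

definition cumulant_transform ::
    "(rat \<Rightarrow> 'a::comm_ring_1) \<Rightarrow> 'a \<Rightarrow> (nat \<Rightarrow> 'a) \<Rightarrow> 'a fps" where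
  "cumulant_transform \<iota> t f =
     - (fps_const (unit_inv t) * fps_X * fps_deriv (log_series \<iota> (gen_fun (E_transform t f))))"

definition cumulant ::
    "(rat \<Rightarrow> 'a::comm_ring_1) \<Rightarrow> 'a \<Rightarrow> (nat \<Rightarrow> 'a) \<Rightarrow> nat \<Rightarrow> 'a" where
  "cumulant \<iota> t f n = fps_nth (cumulant_transform \<iota> t f) n"

text \<open>Multivariate polynomials over \<open>'a\<close> with variables indexed by \<^typ>\<open>nat\<close>: finitely
  supported maps from monomials (finitely supported exponent functions) to coefficients.\<close>

type_synonym 'a mpoly = "(nat \<Rightarrow>\<^sub>0 nat) \<Rightarrow>\<^sub>0 'a"

definition mpoly_vars :: "'a::comm_ring_1 mpoly \<Rightarrow> nat set" where
  "mpoly_vars P = (\<Union>m\<in>Poly_Mapping.keys P. Poly_Mapping.keys m)"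

definition mpoly_eval :: "'a::comm_ring_1 mpoly \<Rightarrow> (nat \<Rightarrow> 'a) \<Rightarrow> 'a" where
  "mpoly_eval P x =
     (\<Sum>m\<in>Poly_Mapping.keys P. Poly_Mapping.lookup P m *
        (\<Prod>i\<in>Poly_Mapping.keys m. x i ^ Poly_Mapping.lookup m i))"

end

(*
  Over a commutative Q-algebra the linear equation Y' = Y D has at most one solution with a given
  constant term, because every positive integer can be cancelled. Both G = G(E_t f) and exp(log G)
  solve it for D = (log G)', so exp(log G) = G. By construction log G is the exponent
  -t sum kappa_n z^n / n. Comparing coefficients in z G' = z G (log G)' gives
  n g(n) = -t sum_{i<n} g(i) kappa_{n-i} for g = E_t f, so by induction g(n) is a polynomial in
  kappa_1, ..., kappa_n.
*)
theory Submission
  imports Defs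
begin

unbundle fps_syntax

section \<open>Composition of power series over a commutative ring\<close>

text \<open>As \<open>F\<close> has no constant term, \<open>F ^ i\<close> has no terms below degree
  \<open>i\<close>. One finite sum thus gives all coefficients up to \<open>N\<close> at once, and
  it can be differentiated and multiplied termwise.\<close>

lemma fps_compose_nth_le:
  fixes A F :: "'a::comm_ring_1 fps"
  assumes "F $ 0 = 0" and "m \<le> N"
  shows "(A oo F) $ m = (\<Sum>i\<le>N. fps_const (A $ i) * F ^ i) $ m"
proof -
  have "(A oo F) $ m = (\<Sum>i\<le>m. A $ i * F ^ i $ m)"
    by (simp add: fps_compose_nth atLeast0AtMost)
  also have "\<dots> = (\<Sum>i\<le>N. A $ i * F ^ i $ m)"
    using assms by (intro sum.mono_neutral_left) (auto simp: startsby_zero_power_prefix)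
  finally show ?thesis
    by (simp add: fps_sum_nth)
qed

lemma fps_mult_nth_cong:
  assumes "\<And>m. m \<le> n \<Longrightarrow> A $ m = A' $ m" and "\<And>m. m \<le> n \<Longrightarrow> B $ m = B' $ m"
  shows "(A * B) $ n = (A' * B') $ n"
  unfolding fps_mult_nth using assms by (intro sum.cong) auto

lemma fps_power_nth_cong:
  assumes "\<And>m. m \<le> n \<Longrightarrow> A $ m = B $ m"
  shows "(A ^ i) $ n = (B ^ i) $ n"
  using assms
proof (induction i arbitrary: n)
  case (Suc i)
  then show ?case
    by (auto intro!: fps_mult_nth_cong)
qed simp

text \<open>Coefficient \<open>n\<close> involves only \<open>F ^ i\<close> for \<open>i\<close> up
  to \<open>n\<close>, each read up to degree \<open>n\<close>. This later justifies cutting the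
  cumulant series off after degree \<open>n\<close>.\<close>

lemma fps_compose_nth_cong:
  assumes "\<And>m. m \<le> n \<Longrightarrow> F $ m = G $ m"
  shows "(A oo F) $ n = (A oo G) $ n"
  unfolding fps_compose_nth using fps_power_nth_cong[OF assms] by simp

text \<open>For each coefficient the composite may be replaced by a finite sum of powers of
  \<open>F\<close>, where the chain rule reduces to the power rule.\<close>

lemma fps_deriv_compose:
  fixes A F :: "'a::comm_ring_1 fps"
  assumes "F $ 0 = 0"
  shows "fps_deriv (A oo F) = (fps_deriv A oo F) * fps_deriv F"
proof (rule fps_ext)
  fix n
  have "fps_deriv (A oo F) $ n = fps_deriv (\<Sum>i\<le>Suc n. fps_const (A $ i) * F ^ i) $ n"
    unfolding fps_deriv_nth using fps_compose_nth_le[OF assms order_refl] by simp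
  \<comment> \<open>The term of index 0 is constant and vanishes; the factor \<open>Suc i\<close>
    from the power rule turns the shifted coefficients of \<open>A\<close> into those of
    \<open>fps_deriv A\<close>.\<close>
  also have "fps_deriv (\<Sum>i\<le>Suc n. fps_const (A $ i) * F ^ i) =
      (\<Sum>i\<le>n. fps_const (fps_deriv A $ i) * F ^ i) * fps_deriv F"
    unfolding sum.atMost_Suc_shift sum_distrib_right
    by (simp add: fps_deriv_sum fps_deriv_power' fps_of_nat[symmetric] mult_ac del: power_Suc)
  also have "\<dots> $ n = ((fps_deriv A oo F) * fps_deriv F) $ n"
    by (intro fps_mult_nth_cong fps_compose_nth_le[OF assms, symmetric]) auto
  finally show "fps_deriv (A oo F) $ n = ((fps_deriv A oo F) * fps_deriv F) $ n" .
qed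

lemma fps_X_mult_compose:
  fixes A F :: "'a::comm_ring_1 fps"
  assumes "F $ 0 = 0"
  shows "fps_X * A oo F = F * (A oo F)"
proof (rule fps_ext)
  fix n
  have "(fps_X * A oo F) $ n = (\<Sum>i\<le>Suc n. fps_const ((fps_X * A) $ i) * F ^ i) $ n"
    by (rule fps_compose_nth_le[OF assms]) simp
  also have "(\<Sum>i\<le>Suc n. fps_const ((fps_X * A) $ i) * F ^ i) =
      F * (\<Sum>i\<le>n. fps_const (A $ i) * F ^ i)"
    unfolding sum.atMost_Suc_shift sum_distrib_left by (simp add: mult_ac)
  also have "\<dots> $ n = (F * (A oo F)) $ n"
    by (intro fps_mult_nth_cong fps_compose_nth_le[OF assms, symmetric]) auto
  finally show "(fps_X * A oo F) $ n = (F * (A oo F)) $ n" .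
qed

text \<open>Inverses in a commutative ring are unique, so the definite description in
  \<open>unit_inv\<close> denotes.\<close>

lemma unit_inv_right:
  fixes u :: "'a::comm_ring_1"
  assumes "u dvd 1"
  shows "u * unit_inv u = 1"
proof -
  obtain v where v: "u * v = 1"
    using assms by (metis dvdE)
  have "w = v" if "u * w = 1" for w
    using v that by (metis mult.assoc mult.commute mult.right_neutral)
  with v show ?thesis
    unfolding unit_inv_def by (rule theI[of "\<lambda>v. u * v = 1"])
qed

section \<open>Exponential and logarithm over a \<open>\<rat>\<close>-algebra\<close>

context rat_algebra
begin

lemma map_zero: "\<iota> 0 = 0"
  using map_add[of 0 0] by simp

lemma map_of_nat: "\<iota> (of_nat n) = of_nat n"
  by (induction n) (simp_all add: map_zero map_add map_one)

lemma map_uminus: "\<iota> (- q) = - \<iota> q"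
  using map_add[of q "- q"] by (simp add: map_zero eq_neg_iff_add_eq_0 add.commute)

lemma map_power: "\<iota> (q ^ n) = \<iota> q ^ n"
  by (induction n) (simp_all add: map_one map_mult)

lemma of_nat_mult_map: "of_nat n * \<iota> q = \<iota> (of_nat n * q)"
  by (simp add: map_mult map_of_nat)

lemma map_inverse_of_nat: "n > 0 \<Longrightarrow> \<iota> (1 / of_nat n) * of_nat n = 1"
  using of_nat_mult_map[of n "1 / of_nat n"] by (simp add: map_one mult.commute)

text \<open>The image of \<open>1 / of_nat n\<close> inverts \<open>of_nat n\<close>, so
  cancellation works even in the presence of zero divisors.\<close>

lemma of_nat_mult_cancel:
  fixes x y :: 'a
  assumes "n > 0" and "of_nat n * x = of_nat n * y"
  shows "x = y"
proof -
  have "\<iota> (1 / of_nat n) * of_nat n * x = \<iota> (1 / of_nat n) * of_nat n * y"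
    using assms(2) by (simp add: mult.assoc)
  with map_inverse_of_nat[OF assms(1)] show ?thesis
    by simp
qed

text \<open>Coefficient \<open>m\<close> of \<open>G * D\<close> involves only coefficients of
  \<open>G\<close> up to \<open>m\<close>, while that of the derivative is \<open>m + 1\<close>
  times the next one. Strong induction therefore determines \<open>G\<close>.\<close>

lemma linear_ode_unique:
  fixes D G H :: "'a fps"
  assumes "fps_deriv G = G * D" and "fps_deriv H = H * D" and "G $ 0 = H $ 0"
  shows "G = H"
proof (rule fps_ext)
  show "G $ n = H $ n" for n
  proof (induction n rule: less_induct)
    case (less n)
    show ?case
    proof (cases n)
      case 0
      with assms(3) show ?thesis by simp
    next
      case (Suc m)
      have "fps_deriv G $ m = fps_deriv H $ m"
        unfolding assms(1,2) by (rule fps_mult_nth_cong) (use less Suc in auto)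
      then have "of_nat n * G $ n = of_nat n * H $ n"
        using Suc by simp
      then show ?thesis
        using of_nat_mult_cancel[of n] Suc by blast
    qed
  qed
qed

lemma fps_deriv_exp_series:
  assumes "F $ 0 = 0"
  shows "fps_deriv (exp_series \<iota> F) = exp_series \<iota> F * fps_deriv F"
proof -
  have "fps_deriv (Abs_fps (\<lambda>n. \<iota> (1 / fact n))) = Abs_fps (\<lambda>n. \<iota> (1 / fact n))"
    by (rule fps_ext) (simp add: of_nat_mult_map del: of_nat_Suc)
  then show ?thesis
    unfolding exp_series_def fps_deriv_compose[OF assms] by simp
qed

lemma exp_series_nth_0: "exp_series \<iota> F $ 0 = 1"
  by (simp add: exp_series_def map_one)

lemma log_series_nth_0: "log_series \<iota> G $ 0 = 0"
  by (simp add: log_series_def)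

text \<open>The derivative of log(1 + z) is the alternating geometric series \<open>D\<close>, the
  inverse of 1 + z; substituting \<open>G - 1\<close> for z makes \<open>D oo (G - 1)\<close> the
  inverse of \<open>G\<close>.\<close>

lemma fps_deriv_log_series:
  assumes "G $ 0 = 1"
  shows "G * fps_deriv (log_series \<iota> G) = fps_deriv G"
proof -
  define D where "D = Abs_fps (\<lambda>n. (- 1) ^ n :: 'a)"
  have "fps_deriv (Abs_fps (\<lambda>n. if n = 0 then 0 else \<iota> ((- 1) ^ (n + 1) / of_nat n))) = D"
    by (rule fps_ext)
      (simp add: D_def of_nat_mult_map map_power map_uminus map_one del: of_nat_Suc)
  moreover have G0: "(G - 1) $ 0 = 0"
    using assms by simp
  ultimately have deriv: "fps_deriv (log_series \<iota> G) = (D oo (G - 1)) * fps_deriv G"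
    unfolding log_series_def by (simp add: fps_deriv_compose)
  have "D + fps_X * D = 1"
  proof (rule fps_ext)
    show "(D + fps_X * D) $ n = 1 $ n" for n
      by (cases n) (simp_all add: D_def)
  qed
  then have "1 oo (G - 1) = (D oo (G - 1)) + (G - 1) * (D oo (G - 1))"
    by (metis fps_compose_add_distrib fps_X_mult_compose[OF G0])
  then have "G * (D oo (G - 1)) = 1"
    by (simp add: algebra_simps)
  then show ?thesis
    unfolding deriv by (simp add: mult.assoc[symmetric])
qed

lemma exp_series_log_series:
  assumes "G $ 0 = 1"
  shows "exp_series \<iota> (log_series \<iota> G) = G"
proof (rule linear_ode_unique)
  show "fps_deriv (exp_series \<iota> (log_series \<iota> G)) =
      exp_series \<iota> (log_series \<iota> G) * fps_deriv (log_series \<iota> G)"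
    by (rule fps_deriv_exp_series[OF log_series_nth_0])
  show "fps_deriv G = G * fps_deriv (log_series \<iota> G)"
    by (rule fps_deriv_log_series[OF assms, symmetric])
  show "exp_series \<iota> (log_series \<iota> G) $ 0 = G $ 0"
    using assms by (simp add: exp_series_nth_0)
qed

section \<open>Cumulants as rescaled coefficients of the logarithm\<close>

lemma cumulant_eq: "cumulant \<iota> t f n =
    - (unit_inv t * of_nat n * log_series \<iota> (gen_fun (E_transform t f)) $ n)"
  unfolding cumulant_def cumulant_transform_def
  by (cases n) (simp_all add: mult.assoc)

text \<open>The factors \<open>t\<close> and 1/n undo the division by \<open>t\<close> and the
  multiplication by n that z d/dz causes. The lost coefficient 0 does no harm, since the logarithm
  has constant term 0.\<close>

lemma log_series_eq_cumulants:
  assumes "t dvd 1"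
  shows "- (fps_const t * Abs_fps (\<lambda>n. if n = 0 then 0 else \<iota> (1 / of_nat n) * cumulant \<iota> t f n)) =
    log_series \<iota> (gen_fun (E_transform t f))"
proof (rule fps_ext)
  fix n
  let ?L = "log_series \<iota> (gen_fun (E_transform t f))"
  show "(- (fps_const t *
      Abs_fps (\<lambda>n. if n = 0 then 0 else \<iota> (1 / of_nat n) * cumulant \<iota> t f n))) $ n = ?L $ n"
  proof (cases "n = 0")
    case False
    have "t * (\<iota> (1 / of_nat n) * (unit_inv t * of_nat n * ?L $ n)) =
        (t * unit_inv t) * (\<iota> (1 / of_nat n) * of_nat n) * ?L $ n"
      by (simp only: mult_ac)
    also have "\<dots> = ?L $ n"
      using False by (simp add: unit_inv_right[OF assms] map_inverse_of_nat)
    finally show ?thesis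
      using False by (simp add: cumulant_eq)
  qed (simp add: log_series_nth_0)
qed

lemma E_transform_recurrence:
  assumes "t dvd 1" and "n > 0"
  shows "E_transform t f n =
    - (\<iota> (1 / of_nat n) * t) * (\<Sum>i<n. E_transform t f i * cumulant \<iota> t f (n - i))"
proof -
  let ?g = "E_transform t f"
  let ?G = "gen_fun ?g"
  let ?L = "log_series \<iota> ?G"
  obtain m where m: "n = Suc m"
    using assms(2) by (cases n) auto
  have coeff: "of_nat k * ?L $ k = - t * cumulant \<iota> t f k" for k
  proof -
    have "- t * cumulant \<iota> t f k = (t * unit_inv t) * (of_nat k * ?L $ k)"
      by (simp add: cumulant_eq mult_ac)
    then show ?thesis
      by (simp add: unit_inv_right[OF assms(1)])
  qed
  have "of_nat n * ?g n = fps_deriv ?G $ m"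
    by (simp add: m gen_fun_def)
  also have "\<dots> = (?G * fps_deriv ?L) $ m"
    by (subst fps_deriv_log_series) (simp_all add: gen_fun_def E_transform_def)
  \<comment> \<open>Since \<open>n = Suc m\<close>, the range up to \<open>m\<close> becomes
    \<open>i < n\<close>, and \<open>Suc (m - i)\<close> becomes \<open>n - i\<close>, which is
    never 0.\<close>
  also have "\<dots> = (\<Sum>i<n. ?g i * (of_nat (n - i) * ?L $ (n - i)))"
    unfolding fps_mult_nth m
    by (intro sum.cong) (auto simp: gen_fun_def Suc_diff_le simp del: of_nat_Suc)
  also have "\<dots> = - t * (\<Sum>i<n. ?g i * cumulant \<iota> t f (n - i))"
    unfolding coeff by (simp add: sum_distrib_left sum_negf mult_ac)
  finally have "\<iota> (1 / of_nat n) * (of_nat n * ?g n) =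
      \<iota> (1 / of_nat n) * (- t * (\<Sum>i<n. ?g i * cumulant \<iota> t f (n - i)))"
    by simp
  then show ?thesis
    using map_inverse_of_nat[OF assms(2)] by (simp add: mult.assoc[symmetric])
qed

end

section \<open>Polynomial functions\<close>

text \<open>Hiding the witness polynomial leaves only closure properties to be used when following
  the recurrence.\<close>

definition polynomial_on :: "nat set \<Rightarrow> ((nat \<Rightarrow> 'a::comm_ring_1) \<Rightarrow> 'a) \<Rightarrow> bool" where
  "polynomial_on S g \<longleftrightarrow> (\<exists>P :: 'a mpoly. mpoly_vars P \<subseteq> S \<and> (\<forall>x. g x = mpoly_eval P x))"

definition monomial_eval :: "(nat \<Rightarrow>\<^sub>0 nat) \<Rightarrow> (nat \<Rightarrow> 'a::comm_ring_1) \<Rightarrow> 'a" where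
  "monomial_eval m x = (\<Prod>i\<in>Poly_Mapping.keys m. x i ^ Poly_Mapping.lookup m i)"

text \<open>Indices outside the support contribute \<open>x i ^ 0 = 1\<close>, so two monomials can
  be evaluated over a common index set.\<close>

lemma monomial_eval_superset:
  assumes "finite A" and "Poly_Mapping.keys m \<subseteq> A"
  shows "monomial_eval m x = (\<Prod>i\<in>A. x i ^ Poly_Mapping.lookup m i)"
  unfolding monomial_eval_def using assms
  by (intro prod.mono_neutral_left) (auto simp: in_keys_iff)

lemma monomial_eval_add: "monomial_eval (m + m') x = monomial_eval m x * monomial_eval m' x"
proof -
  let ?A = "Poly_Mapping.keys m \<union> Poly_Mapping.keys m'"
  have "monomial_eval (m + m') x = (\<Prod>i\<in>?A. x i ^ Poly_Mapping.lookup (m + m') i)"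
    by (rule monomial_eval_superset) (simp_all add: keys_add)
  also have "\<dots> = (\<Prod>i\<in>?A. x i ^ Poly_Mapping.lookup m i) * (\<Prod>i\<in>?A. x i ^ Poly_Mapping.lookup m' i)"
    by (simp add: lookup_add power_add prod.distrib)
  finally show ?thesis
    by (simp add: monomial_eval_superset[of ?A])
qed

text \<open>A common index set makes evaluation additive termwise, although cancellation may shrink
  the support of a sum.\<close>

lemma mpoly_eval_superset:
  assumes "finite A" and "Poly_Mapping.keys P \<subseteq> A"
  shows "mpoly_eval P x = (\<Sum>m\<in>A. Poly_Mapping.lookup P m * monomial_eval m x)"
  unfolding mpoly_eval_def monomial_eval_def[symmetric] using assms
  by (intro sum.mono_neutral_left) (auto simp: in_keys_iff)

lemma mpoly_eval_add: "mpoly_eval (P + Q) x = mpoly_eval P x + mpoly_eval Q x"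
proof -
  let ?A = "Poly_Mapping.keys P \<union> Poly_Mapping.keys Q"
  have "mpoly_eval (P + Q) x = (\<Sum>m\<in>?A. Poly_Mapping.lookup (P + Q) m * monomial_eval m x)"
    by (rule mpoly_eval_superset) (simp_all add: keys_add)
  then show ?thesis
    by (simp add: mpoly_eval_superset[of ?A] lookup_add distrib_right sum.distrib)
qed

lemma polynomial_on_add:
  assumes "polynomial_on S g" and "polynomial_on S h"
  shows "polynomial_on S (\<lambda>x. g x + h x)"
proof -
  obtain P Q where P: "mpoly_vars P \<subseteq> S" "\<forall>x. g x = mpoly_eval P x"
    and Q: "mpoly_vars Q \<subseteq> S" "\<forall>x. h x = mpoly_eval Q x"
    using assms unfolding polynomial_on_def by blast
  have "mpoly_vars (P + Q) \<subseteq> S"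
    using P(1) Q(1) keys_add[of P Q] unfolding mpoly_vars_def by blast
  moreover have "\<forall>x. g x + h x = mpoly_eval (P + Q) x"
    using P(2) Q(2) by (simp add: mpoly_eval_add)
  ultimately show ?thesis
    unfolding polynomial_on_def by blast
qed

lemma polynomial_on_monomial:
  assumes "Poly_Mapping.keys m \<subseteq> S"
  shows "polynomial_on S (\<lambda>x. c * monomial_eval m x)"
proof -
  have "mpoly_vars (Poly_Mapping.single m c) \<subseteq> S"
    using assms by (simp add: mpoly_vars_def)
  \<comment> \<open>Summing over \<open>{m}\<close> also covers \<open>c = 0\<close>, where the
    support is empty.\<close>
  moreover have "\<forall>x. c * monomial_eval m x = mpoly_eval (Poly_Mapping.single m c) x"
    by (simp add: mpoly_eval_superset[of "{m}"])
  ultimately show ?thesis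
    unfolding polynomial_on_def by blast
qed

lemma polynomial_on_const: "polynomial_on S (\<lambda>_. c)"
  using polynomial_on_monomial[of 0 S c] by (simp add: monomial_eval_def)

lemma polynomial_on_var: "i \<in> S \<Longrightarrow> polynomial_on S (\<lambda>x. x i)"
  using polynomial_on_monomial[of "Poly_Mapping.single i 1" S 1] by (simp add: monomial_eval_def)

lemma polynomial_on_sum:
  assumes "\<And>i. i \<in> A \<Longrightarrow> polynomial_on S (g i)"
  shows "polynomial_on S (\<lambda>x. \<Sum>i\<in>A. g i x)"
  using assms
proof (induction A rule: infinite_finite_induct)
  case (insert i A)
  have "polynomial_on S (\<lambda>x. g i x + (\<Sum>i\<in>A. g i x))"
    by (rule polynomial_on_add) (use insert in auto)
  with insert.hyps show ?case
    by simp
qed (simp_all add: polynomial_on_const)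

text \<open>Expanding the product of the two evaluations gives a double sum of monomials, so closure
  under sums suffices.\<close>

lemma polynomial_on_mult:
  assumes "polynomial_on S g" and "polynomial_on S h"
  shows "polynomial_on S (\<lambda>x. g x * h x)"
proof -
  obtain P Q where P: "mpoly_vars P \<subseteq> S" "\<And>x. g x = mpoly_eval P x"
    and Q: "mpoly_vars Q \<subseteq> S" "\<And>x. h x = mpoly_eval Q x"
    using assms unfolding polynomial_on_def by blast
  have "g x * h x = (\<Sum>m\<in>Poly_Mapping.keys P. \<Sum>m'\<in>Poly_Mapping.keys Q.
      Poly_Mapping.lookup P m * Poly_Mapping.lookup Q m' * monomial_eval (m + m') x)" for x
    unfolding P(2) Q(2) mpoly_eval_def monomial_eval_def[symmetric] sum_product
    by (simp add: monomial_eval_add mult_ac)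
  moreover have "Poly_Mapping.keys (m + m') \<subseteq> S"
    if "m \<in> Poly_Mapping.keys P" "m' \<in> Poly_Mapping.keys Q" for m m'
    using that P(1) Q(1) keys_add[of m m'] unfolding mpoly_vars_def by blast
  ultimately show ?thesis
    by (simp add: polynomial_on_sum polynomial_on_monomial)
qed

lemma polynomial_on_mono: "polynomial_on S g \<Longrightarrow> S \<subseteq> T \<Longrightarrow> polynomial_on T g"
  unfolding polynomial_on_def by blast

text \<open>Strong induction along the recurrence; choosing \<open>g\<close> before \<open>f\<close>
  makes one polynomial serve all sequences.\<close>

lemma (in rat_algebra) E_transform_polynomial:
  assumes "t dvd 1"
  shows "\<exists>g. polynomial_on {1..n} g \<and> (\<forall>f. E_transform t f n = g (cumulant \<iota> t f))"
proof (induction n rule: less_induct)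
  case (less n)
  show ?case
  proof (cases "n = 0")
    case True
    then show ?thesis
      using polynomial_on_const[of _ "1::'a"] by (auto simp: E_transform_def)
  next
    case False
    obtain g where g: "\<And>i. i < n \<Longrightarrow> polynomial_on {1..i} (g i)"
      "\<And>i f. i < n \<Longrightarrow> E_transform t f i = g i (cumulant \<iota> t f)"
      using less.IH by metis
    \<comment> \<open>This is the right side of the recurrence with the cumulants replaced by free
      variables; for \<open>i < n\<close> the index \<open>n - i\<close> stays in
      \<open>{1..n}\<close>.\<close>
    let ?h = "\<lambda>x. - (\<iota> (1 / of_nat n) * t) * (\<Sum>i<n. g i x * x (n - i))"
    have "polynomial_on {1..n} (g i)" if "i < n" for i
      using g(1)[OF that] that by (auto intro: polynomial_on_mono)
    then have "polynomial_on {1..n} ?h"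
      by (intro polynomial_on_mult polynomial_on_const polynomial_on_sum polynomial_on_var) auto
    moreover have "\<forall>f. E_transform t f n = ?h (cumulant \<iota> t f)"
      using False by (simp add: E_transform_recurrence[OF assms] g(2))
    ultimately show ?thesis
      by blast
  qed
qed

section \<open>Recovering a sequence from its cumulants\<close>

lemma OmegaD:
  assumes "t \<in> Omega"
  shows "t dvd 1" and "falling_fact t n dvd 1"
proof -
  show "falling_fact t n dvd 1"
    using assms by (cases "n = 0") (auto simp: Omega_def falling_fact_def)
  have "falling_fact t 1 dvd 1"
    using assms by (simp add: Omega_def)
  then show "t dvd 1"
    by (simp add: falling_fact_def)
qed

text \<open>For positive \<open>n\<close> the transform scales by a unit, which is undone; at 0 it
  agrees with \<open>f\<close> because \<open>f 0 = 1\<close>.\<close>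

lemma E_transform_inverse:
  assumes "t \<in> Omega" and "f \<in> UH"
  shows "f n = falling_fact t n * unit_inv (t ^ n) * E_transform t f n"
proof (cases "n = 0")
  case True
  have "(1::'a) * unit_inv 1 = 1"
    by (rule unit_inv_right) simp
  with True assms(2) show ?thesis
    by (simp add: UH_def E_transform_def falling_fact_def)
next
  case False
  have "t ^ n dvd 1"
    using OmegaD(1)[OF assms(1)] dvd_power_same[of t 1 n] by simp
  then have "(t ^ n * unit_inv (t ^ n)) * (falling_fact t n * unit_inv (falling_fact t n)) * f n = f n"
    by (simp add: unit_inv_right OmegaD(2)[OF assms(1)])
  with False show ?thesis
    by (simp add: E_transform_def mult_ac)
qed

theorem proposition3p2:
  fixes \<iota> :: "rat \<Rightarrow> 'a::comm_ring_1" and t :: 'a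
  assumes "rat_algebra \<iota>" and "t \<in> Omega"
  shows "(\<forall>f\<in>UH.
            gen_fun (E_transform t f) =
              exp_series \<iota> (- (fps_const t *
                Abs_fps (\<lambda>n. if n = 0 then 0 else \<iota> (1 / of_nat n) * cumulant \<iota> t f n)))) \<and>
         (\<forall>f\<in>UH. \<forall>n.
            f n = falling_fact t n * unit_inv (t ^ n) *
              fps_nth (exp_series \<iota> (- (fps_const t *
                (\<Sum>j=1..n. fps_const (\<iota> (1 / of_nat j) * cumulant \<iota> t f j) * fps_X ^ j)))) n) \<and>
         inj_on (cumulant_transform \<iota> t) UH \<and>
         (\<forall>n. \<exists>P :: 'a mpoly. mpoly_vars P \<subseteq> {1..n} \<and>
            (\<forall>f\<in>UH. f n = mpoly_eval P (cumulant \<iota> t f)))"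
proof (intro conjI ballI allI)
  interpret rat_algebra \<iota> by (rule assms(1))
  note t = OmegaD(1)[OF assms(2)]
  note inverse = E_transform_inverse[OF assms(2)]
  let ?A = "\<lambda>f. Abs_fps (\<lambda>n. if n = 0 then 0 else \<iota> (1 / of_nat n) * cumulant \<iota> t f n)"
  have G0: "gen_fun (E_transform t f) $ 0 = 1" for f
    by (simp add: gen_fun_def E_transform_def)
  show gen: "gen_fun (E_transform t f) = exp_series \<iota> (- (fps_const t * ?A f))" for f
    unfolding log_series_eq_cumulants[OF t] exp_series_log_series[OF G0] ..
  show "f n = falling_fact t n * unit_inv (t ^ n) *
      fps_nth (exp_series \<iota> (- (fps_const t *
        (\<Sum>j=1..n. fps_const (\<iota> (1 / of_nat j) * cumulant \<iota> t f j) * fps_X ^ j)))) n"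
    (is "_ = _ * fps_nth (exp_series \<iota> ?T) n")
    if "f \<in> UH" for f n
  proof -
    \<comment> \<open>The truncated exponent and the full one agree up to degree \<open>n\<close>,
      which is all that coefficient \<open>n\<close> sees.\<close>
    have "fps_nth (exp_series \<iota> ?T) n = exp_series \<iota> (- (fps_const t * ?A f)) $ n"
      unfolding exp_series_def
      by (rule fps_compose_nth_cong)
        (simp add: fps_sum_nth if_distrib[of "\<lambda>x. _ * x"] sum.delta cong: if_cong)
    also have "\<dots> = E_transform t f n"
      unfolding gen[symmetric] by (simp add: gen_fun_def)
    finally show ?thesis
      using inverse[OF that] by simp
  qed
  show "inj_on (cumulant_transform \<iota> t) UH"
  proof (rule inj_onI)
    fix f g
    assume fg: "f \<in> UH" "g \<in> UH" and "cumulant_transform \<iota> t f = cumulant_transform \<iota> t g"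
    then have "cumulant \<iota> t f = cumulant \<iota> t g"
      by (simp add: cumulant_def fun_eq_iff)
    \<comment> \<open>By the exponential formula the generating function depends on the sequence
      only through its cumulants.\<close>
    then have "gen_fun (E_transform t f) = gen_fun (E_transform t g)"
      by (simp only: gen)
    then have "E_transform t f = E_transform t g"
      by (simp add: gen_fun_def fps_eq_iff fun_eq_iff)
    with inverse[OF fg(1)] inverse[OF fg(2)] show "f = g"
      by (metis ext)
  qed
  show "\<exists>P :: 'a mpoly. mpoly_vars P \<subseteq> {1..n} \<and>
      (\<forall>f\<in>UH. f n = mpoly_eval P (cumulant \<iota> t f))" for n
  proof -
    obtain g where g: "polynomial_on {1..n} g" "\<And>f. E_transform t f n = g (cumulant \<iota> t f)"
      using E_transform_polynomial[OF t] by metis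
    \<comment> \<open>Undoing the deformation multiplies by a constant independent of
      \<open>f\<close>.\<close>
    have "polynomial_on {1..n} (\<lambda>x. falling_fact t n * unit_inv (t ^ n) * g x)"
      by (intro polynomial_on_mult polynomial_on_const g)
    then show ?thesis
      unfolding polynomial_on_def using inverse[of _ n] g(2) by metis
  qed
qed

end
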